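(* Let $n\ge1$. There exist continuous, translation invariant valuations on $\mathrm{Conv}_{\rm sc}(\mathbb{R}^n)$ which cannot be written as finite sums of epi-homogeneous valuations on $\mathrm{Conv}_{\rm sc}(\mathbb{R}^n)$.
   Context: $\mathrm{Conv}(\mathbb{R}^n)$ is the set of convex, lower semicontinuous functions $u\colon\mathbb{R}^n\to\mathbb{R}\cup\{+\infty\}$ with $u\not\equiv+\infty$. $\mathrm{Conv}_{\rm sc}(\mathbb{R}^n)$ is the subset of super-coercive functions, i.e. those with $\lim_{|x|\to+\infty}u(x)/|x|=+\infty$. Topology: continuity is with respect to epi-convergence. A sequence $u_k$ epi-converges to $u$ if for every $x\in\mathbb{R}^n$: (i) $u(x)\le\liminf_{k\to\infty}u_k(x_k)$ for every sequence $x_k\to x$, and (ii) there is a sequence $x_k\to x$ with $u(x)=\lim_{k\to\infty}u_k(x_k)$. A functional $Z\colon X\to\mathbb{R}$ on a set $X$ of functions is a valuation if $Z(u\vee v)+Z(u\wedge v)=Z(u)+Z(v)$ for all $u,v\in X$ with $u\vee v\in X$ and $u\wedge v\in X$, where $\vee$ and $\wedge$ denote pointwise maximum and minimum. $Z$ is translation invariant if $Z(u\circ\tau^{-1})=Z(u)$ for all $u$ and all translations $\tau\colon\mathbb{R}^n\to\mathbb{R}^n$. For $\lambda>0$, epi-multiplication is $(\lambda\cdot_{\rm epi}u)(x)=\lambda\,u(x/\lambda)$. $Z$ is epi-homogeneous if there is $\alpha\in\mathbb{R}$ (the degree) such that $Z(\lambda\cdot_{\rm epi}u)=\lambda^\alpha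 Z(u)$ for all $u$ and all $\lambda>0$. The summands in a finite sum may have different degrees. *)

theory Defs
  imports "HOL-Analysis.Analysis"
begin

(* Functions with values in the reals extended by plus infinity are total functions
   into ereal that omit the value -\<infinity>. *)

definition convex_ereal :: "('a::real_vector \<Rightarrow> ereal) \<Rightarrow> bool" where
  "convex_ereal u \<longleftrightarrow>
    (\<forall>x y. \<forall>t\<in>{0..1::real}. u ((1 - t) *\<^sub>R x + t *\<^sub>R y) \<le> ereal (1 - t) * u x + ereal t * u y)"

definition lower_semicontinuous :: "('a::topological_space \<Rightarrow> ereal) \<Rightarrow> bool" where
  "lower_semicontinuous u \<longleftrightarrow> (\<forall>x. u x \<le> Liminf (at x) u)"

definition Conv :: "('a::euclidean_space \<Rightarrow> ereal) set" where
  "Conv = {u. (\<forall>x. u x \<noteq> -\<infinity>) \<and> (\<exists>x. u x \<noteq> \<infinity>) \<and> convex_ereal u \<and> lower_semicontinuous u}"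

definition Conv_sc :: "('a::euclidean_space \<Rightarrow> ereal) set" where
  "Conv_sc = {u \<in> Conv. ((\<lambda>x. u x / ereal (norm x)) \<longlongrightarrow> \<infinity>) at_infinity}"

definition epi_converges :: "(nat \<Rightarrow> 'a::topological_space \<Rightarrow> ereal) \<Rightarrow> ('a \<Rightarrow> ereal) \<Rightarrow> bool" where
  "epi_converges U u \<longleftrightarrow>
    (\<forall>x. (\<forall>X. X \<longlonglongrightarrow> x \<longrightarrow> u x \<le> liminf (\<lambda>k. U k (X k))) \<and>
         (\<exists>X. X \<longlonglongrightarrow> x \<and> (\<lambda>k. U k (X k)) \<longlonglongrightarrow> u x))"

(* A functional on a set \<X> of functions is a total function whose values outside \<X>
   are irrelevant. *)

definition epi_continuous_on ::
    "('a::topological_space \<Rightarrow> ereal) set \<Rightarrow> (('a \<Rightarrow> ereal) \<Rightarrow> real) \<Rightarrow> bool" where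
  "epi_continuous_on \<X> Z \<longleftrightarrow>
    (\<forall>U u. (\<forall>k. U k \<in> \<X>) \<and> u \<in> \<X> \<and> epi_converges U u \<longrightarrow> (\<lambda>k. Z (U k)) \<longlonglongrightarrow> Z u)"

definition valuation_on :: "('a \<Rightarrow> ereal) set \<Rightarrow> (('a \<Rightarrow> ereal) \<Rightarrow> real) \<Rightarrow> bool" where
  "valuation_on \<X> Z \<longleftrightarrow>
    (\<forall>u\<in>\<X>. \<forall>v\<in>\<X>. (\<lambda>x. max (u x) (v x)) \<in> \<X> \<and> (\<lambda>x. min (u x) (v x)) \<in> \<X> \<longrightarrow>
      Z (\<lambda>x. max (u x) (v x)) + Z (\<lambda>x. min (u x) (v x)) = Z u + Z v)"

definition translation_invariant_on ::
    "('a::group_add \<Rightarrow> ereal) set \<Rightarrow> (('a \<Rightarrow> ereal) \<Rightarrow> real) \<Rightarrow> bool" where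
  "translation_invariant_on \<X> Z \<longleftrightarrow> (\<forall>u\<in>\<X>. \<forall>a. Z (\<lambda>x. u (x - a)) = Z u)"

definition epi_mult :: "real \<Rightarrow> ('a::real_vector \<Rightarrow> ereal) \<Rightarrow> 'a \<Rightarrow> ereal" where
  "epi_mult c u = (\<lambda>x. ereal c * u (x /\<^sub>R c))"

definition epi_homogeneous_on ::
    "('a::real_vector \<Rightarrow> ereal) set \<Rightarrow> (('a \<Rightarrow> ereal) \<Rightarrow> real) \<Rightarrow> bool" where
  "epi_homogeneous_on \<X> Z \<longleftrightarrow>
    (\<exists>\<alpha>::real. \<forall>u\<in>\<X>. \<forall>c>0. Z (epi_mult c u) = c powr \<alpha> * Z u)"

end

theory Submission
  imports Defs
begin

text \<open>The functional is \<open>Z u = exp (min u)\<close>. If the pointwise minimum of \<open>u\<close> and \<open>v\<close> is convex,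
  the minimum of their pointwise maximum is the larger of the two minima, so every function of the minimum is a
  valuation; convexity together with coercivity makes the minimum epi-continuous. Epi-multiplication by
  \<open>c\<close> multiplies the minimum by \<open>c\<close>, so a decomposition of \<open>Z\<close> into epi-homogeneous summands would
  bound \<open>exp c\<close> by a finite sum of powers of \<open>c\<close>.\<close>

section \<open>Sublevel sets, coercivity and finite infima\<close>

lemma lower_semicontinuous_open_superlevel:
  assumes "lower_semicontinuous u"
  shows "open {x. c < u x}"
proof (subst open_subopen, intro ballI)
  fix x assume "x \<in> {x. c < u x}"
  then have c: "c < u x" by simp
  then have "c < Liminf (at x) u"
    using assms unfolding lower_semicontinuous_def by (meson less_le_trans)
  then have "\<forall>\<^sub>F y in at x. c < u y" by (rule less_LiminfD)
  with c have "\<forall>\<^sub>F y in nhds x. c < u y" by (simp add: eventually_nhds_conv_at)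
  then show "\<exists>T. open T \<and> x \<in> T \<and> T \<subseteq> {x. c < u x}"
    unfolding eventually_nhds by auto
qed

lemma lower_semicontinuous_closed_sublevel:
  assumes "lower_semicontinuous u"
  shows "closed {x. u x \<le> c}"
proof -
  have "{x. u x \<le> c} = - {x. c < u x}" by auto
  then show ?thesis
    using lower_semicontinuous_open_superlevel[OF assms, of c] by (metis closed_Compl)
qed

lemma convex_ereal_segment_le:
  assumes "convex_ereal u" "u x \<le> ereal c" "u y \<le> ereal c" "z \<in> closed_segment x y"
  shows "u z \<le> ereal c"
proof -
  obtain t where t: "0 \<le> t" "t \<le> 1" "z = (1 - t) *\<^sub>R x + t *\<^sub>R y"
    using assms(4) by (auto simp: in_segment)
  have "u z \<le> ereal (1 - t) * u x + ereal t * u y"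
    using assms(1) t unfolding convex_ereal_def by auto
  also have "\<dots> \<le> ereal (1 - t) * ereal c + ereal t * ereal c"
    using t assms by (intro add_mono ereal_mult_left_mono) auto
  also have "\<dots> = ereal c" by (simp add: algebra_simps)
  finally show ?thesis .
qed

lemma Conv_sc_coercive:
  fixes u :: "'a::euclidean_space \<Rightarrow> ereal"
  assumes "u \<in> Conv_sc"
  shows "\<forall>\<^sub>F x in at_infinity. ereal c < u x"
proof -
  have "((\<lambda>x. u x / ereal (norm x)) \<longlongrightarrow> \<infinity>) at_infinity"
    using assms by (simp add: Conv_sc_def)
  \<comment> \<open>The threshold is |c| and not \<open>c\<close>, so that multiplying it by a norm
    of at least 1 cannot lower it when \<open>c\<close> is negative.\<close>
  then have "\<forall>\<^sub>F x in at_infinity. ereal \<bar>c\<bar> < u x / ereal (norm x)"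
    by (simp add: tendsto_PInfty)
  moreover have "\<forall>\<^sub>F x in at_infinity. 1 \<le> norm (x::'a)"
    by (auto simp: eventually_at_infinity)
  ultimately show ?thesis
  proof eventually_elim
    case (elim x)
    then have n: "0 < norm x" by linarith
    show ?case
    proof (cases "u x")
      case (real r)
      with elim n have "\<bar>c\<bar> * norm x < r" by (simp add: field_simps)
      moreover have "\<bar>c\<bar> * 1 \<le> \<bar>c\<bar> * norm x"
        using elim by (intro mult_left_mono) auto
      ultimately show ?thesis using real by auto
    next
      case MInf
      with elim n show ?thesis by (simp add: divide_ereal_def)
    qed simp
  qed
qed

text \<open>Outside a ball coercivity makes \<open>u\<close> positive. On the ball, the open sets
  where \<open>u\<close> exceeds \<open>- n\<close> form a cover because \<open>u\<close> omits the
  value minus infinity, and a finite subcover gives a lower bound. Properness excludes plus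
  infinity.\<close>

lemma Conv_sc_INF_finite:
  fixes u :: "'a::euclidean_space \<Rightarrow> ereal"
  assumes "u \<in> Conv_sc"
  shows "\<exists>m. (INF x. u x) = ereal m"
proof -
  have u: "u x \<noteq> -\<infinity>" "lower_semicontinuous u" "\<exists>x. u x \<noteq> \<infinity>" for x
    using assms by (auto simp: Conv_sc_def Conv_def)
  obtain b where b: "\<And>x. b \<le> norm x \<Longrightarrow> ereal 0 < u x"
    using Conv_sc_coercive[OF assms, of 0] by (auto simp: eventually_at_infinity)
  define D where "D n = {x. ereal (- real n) < u x}" for n
  have "\<exists>n. x \<in> D n" for x
  proof (cases "u x")
    case (real r)
    obtain n where "- r < real n" using reals_Archimedean2 by blast
    then show ?thesis using real by (auto simp: D_def intro!: exI[of _ n])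
  qed (use u in \<open>auto simp: D_def\<close>)
  then have cover: "cball 0 b \<subseteq> (\<Union>n\<in>UNIV. D n)" by blast
  have "open (D n)" for n
    unfolding D_def by (rule lower_semicontinuous_open_superlevel[OF u(2)])
  then obtain C where C: "finite C" "cball 0 b \<subseteq> (\<Union>n\<in>C. D n)"
    using compactE_image[OF compact_cball _ cover] by metis
  \<comment> \<open>Inserting 0 keeps \<open>Max\<close> meaningful when \<open>C\<close> is empty.
    The bound is never positive, so it also serves outside the ball.\<close>
  have low: "ereal (- real (Max (insert 0 C))) \<le> u x" for x
  proof (cases "b \<le> norm x")
    case True
    have "ereal (- real (Max (insert 0 C))) \<le> ereal 0" by simp
    then show ?thesis using b[OF True] by (meson le_less_trans less_imp_le)
  next
    case False
    then obtain n where n: "n \<in> C" "x \<in> D n" using C by force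
    have "n \<le> Max (insert 0 C)" using n C by simp
    then have "ereal (- real (Max (insert 0 C))) \<le> ereal (- real n)" by simp
    also have "\<dots> < u x" using n by (simp add: D_def)
    finally show ?thesis by simp
  qed
  then have "ereal (- real (Max (insert 0 C))) \<le> (INF x. u x)" by (intro INF_greatest)
  moreover have "(INF x. u x) \<noteq> \<infinity>"
    using u(3) by (metis INF_lower UNIV_I ereal_infty_less_eq(1))
  ultimately show ?thesis by (cases "INF x. u x") auto
qed

section \<open>Epi-convergence and convergence of infima\<close>

text \<open>Otherwise infinitely many \<open>U k\<close> take a value at most \<open>c\<close> in
  \<open>K\<close>. These points accumulate at some \<open>l\<close> in \<open>K\<close>, and the
  liminf inequality at \<open>l\<close> gives \<open>u l\<close> \<le> \<open>c\<close> <
  \<open>d\<close>, a contradiction.\<close>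

lemma epi_converges_eventually_compact:
  fixes u :: "'a::metric_space \<Rightarrow> ereal"
  assumes epi: "epi_converges U u" and K: "compact K"
    and c: "c < d" "\<And>x. x \<in> K \<Longrightarrow> d \<le> u x"
  shows "\<forall>\<^sub>F k in sequentially. \<forall>x\<in>K. c < U k x"
proof (rule ccontr)
  assume "\<not> ?thesis"
  then have "\<exists>\<^sub>F k in sequentially. \<exists>x\<in>K. U k x \<le> c"
    by (simp add: frequently_def not_le)
  then obtain r :: "nat \<Rightarrow> nat" where r: "strict_mono r" "\<And>n. \<exists>x\<in>K. U (r n) x \<le> c"
    using infinite_enumerate[of "{k. \<exists>x\<in>K. U k x \<le> c}"]
    by (auto simp: INFM_iff_infinite cofinite_eq_sequentially[symmetric])
  then obtain y where y: "\<And>n. y n \<in> K" "\<And>n. U (r n) (y n) \<le> c" by metis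
  then obtain l s where l: "l \<in> K" "strict_mono s" "(y \<circ> s) \<longlonglongrightarrow> l"
    using K unfolding compact_def by metis
  define q where "q = r \<circ> s"
  have q: "strict_mono q" using r l by (auto simp: q_def strict_mono_o)
  \<comment> \<open>Epi-convergence speaks of full sequences: fill the gaps of the subsequence with its limit.\<close>
  define X where "X k = (if k \<in> range q then y (s (inv q k)) else l)" for k
  have Xq: "X (q n) = y (s n)" for n
    using q by (simp add: X_def strict_mono_imp_inj_on)
  have "X \<longlonglongrightarrow> l"
  proof (rule tendstoI)
    fix e :: real assume e: "e > 0"
    then obtain N where N: "\<And>n. n \<ge> N \<Longrightarrow> dist (y (s n)) l < e"
      using l(3) unfolding lim_sequentially by (auto simp: comp_def)
    have "dist (X k) l < e" if k: "k \<ge> q N" for k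
    proof (cases "k \<in> range q")
      case True
      then obtain n where n: "k = q n" by auto
      then have "n \<ge> N" using k q by (simp add: strict_mono_less_eq)
      then show ?thesis using N n Xq by simp
    qed (use e in \<open>simp add: X_def\<close>)
    then show "\<forall>\<^sub>F k in sequentially. dist (X k) l < e"
      using eventually_sequentially by blast
  qed
  then have "u l \<le> liminf (\<lambda>k. U k (X k))"
    using epi unfolding epi_converges_def by blast
  \<comment> \<open>Passing to a subsequence can only raise the liminf, and along \<open>q\<close>
    every value is at most \<open>c\<close>.\<close>
  also have "\<dots> \<le> liminf ((\<lambda>k. U k (X k)) \<circ> q)" by (rule liminf_subseq_mono[OF q])
  also have "\<dots> \<le> liminf (\<lambda>n::nat. c)"
    using y by (intro Liminf_mono always_eventually) (auto simp: Xq, simp add: q_def)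
  also have "\<dots> = c" by (simp add: Liminf_const)
  finally show False using c l(1) by (meson leD le_less_trans less_le_trans order_trans)
qed

text \<open>The values outside a large ball are controlled through convexity: a segment from a recovery
  sequence to a far point of low value would produce a point of low value on a fixed sphere.\<close>
lemma epi_converges_INF:
  fixes u :: "'a::euclidean_space \<Rightarrow> ereal"
  assumes U: "\<And>k. convex_ereal (U k)" and u: "u \<in> Conv_sc" and epi: "epi_converges U u"
  shows "(\<lambda>k. INF x. U k x) \<longlonglongrightarrow> (INF x. u x)"
proof -
  obtain m where m: "(INF x. u x) = ereal m" using Conv_sc_INF_finite[OF u] by blast
  have um: "ereal m \<le> u x" for x using m by (metis INF_lower UNIV_I)
  \<comment> \<open>The level \<open>m + 1\<close> separates the values near \<open>x0\<close> from
    those on a far sphere. There \<open>u\<close> exceeds \<open>m + 2\<close>, which leaves the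
    strict gap that the compactness lemma consumes.\<close>
  have "(INF x. u x) < ereal (m + 1)" by (simp add: m)
  then obtain x0 where x0: "u x0 < ereal (m + 1)" by (auto simp: INF_less_iff)
  obtain X where X: "X \<longlonglongrightarrow> x0" "(\<lambda>k. U k (X k)) \<longlonglongrightarrow> u x0"
    using epi unfolding epi_converges_def by blast
  obtain b where b: "\<And>x. b \<le> norm x \<Longrightarrow> ereal (m + 2) < u x"
    using Conv_sc_coercive[OF u, of "m + 2"] by (auto simp: eventually_at_infinity)
  \<comment> \<open>By the triangle inequality, a point at distance \<open>R\<close> from
    \<open>x0\<close> has norm at least |b| + 1.\<close>
  define R where "R = \<bar>b\<bar> + norm x0 + 1"
  have R: "R > 0" by (simp add: R_def add_nonneg_pos)
  have far: "ereal (m + 2) \<le> u x" if "x \<in> sphere x0 R" for x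
  proof -
    have "norm (x0 - x) = R" using that by (simp add: dist_norm)
    then have "b \<le> norm x" using norm_triangle_ineq4[of x0 x] by (simp add: R_def)
    then show ?thesis using b by (simp add: less_imp_le)
  qed
  show ?thesis
  proof (rule order_tendstoI)
    \<comment> \<open>Upper bound: a recovery sequence for a point where \<open>u\<close> is below
      \<open>a\<close> suffices.\<close>
    fix a assume "(INF x. u x) < a"
    then obtain x where x: "u x < a" by (auto simp: INF_less_iff)
    obtain W where "(\<lambda>k. U k (W k)) \<longlonglongrightarrow> u x"
      using epi unfolding epi_converges_def by blast
    then have "\<forall>\<^sub>F k in sequentially. U k (W k) < a" using x by (rule order_tendstoD)
    then show "\<forall>\<^sub>F k in sequentially. (INF x. U k x) < a"
      by eventually_elim (meson INF_lower UNIV_I le_less_trans)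
  next
    \<comment> \<open>Lower bound: compactness handles the ball around \<open>x0\<close>, convexity
      its complement.\<close>
    fix a assume "a < (INF x. u x)"
    then obtain a' where a': "a < ereal a'" "a' < m"
      using ereal_dense2[of a "ereal m"] m by auto
    have "\<forall>\<^sub>F k in sequentially. \<forall>x\<in>cball x0 R. ereal a' < U k x"
      using a' um by (intro epi_converges_eventually_compact[OF epi, of _ _ "ereal m"]) auto
    moreover have "\<forall>\<^sub>F k in sequentially. \<forall>x\<in>sphere x0 R. ereal (m + 1) < U k x"
      using far by (intro epi_converges_eventually_compact[OF epi, of _ _ "ereal (m + 2)"]) auto
    moreover have "\<forall>\<^sub>F k in sequentially. U k (X k) < ereal (m + 1)"
      using X(2) x0 by (rule order_tendstoD)
    moreover have "\<forall>\<^sub>F k in sequentially. dist (X k) x0 < R"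
      using X(1) R by (rule tendstoD)
    ultimately show "\<forall>\<^sub>F k in sequentially. a < (INF x. U k x)"
    proof eventually_elim
      case (elim k)
      have "ereal a' \<le> U k y" for y
      proof (cases "y \<in> cball x0 R")
        case True
        then show ?thesis using elim by (simp add: less_imp_le)
      next
        case False
        show ?thesis
        proof (rule ccontr)
          assume "\<not> ?thesis"
          then have low: "U k y \<le> ereal (m + 1)"
            using a' by (cases "U k y") auto
          \<comment> \<open>The segment is connected, starts inside the ball and ends outside, so it
            crosses the sphere, where \<open>U k\<close> exceeds \<open>m + 1\<close>. Both
            endpoints have values at most \<open>m + 1\<close>.\<close>
          have "closed_segment (X k) y \<inter> frontier (cball x0 R) \<noteq> {}"
          proof (rule connected_Int_frontier)
            show "closed_segment (X k) y \<inter> cball x0 R \<noteq> {}"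
              using elim by (auto simp: dist_commute intro!: exI[of _ "X k"])
            show "closed_segment (X k) y - cball x0 R \<noteq> {}" using False by auto
          qed auto
          then obtain z where z: "z \<in> closed_segment (X k) y" "z \<in> sphere x0 R"
            using R by (auto simp del: mem_sphere)
          have "U k z \<le> ereal (m + 1)"
            using convex_ereal_segment_le[OF U _ low z(1)] elim by (simp add: less_imp_le)
          with elim z(2) show False by (meson leD)
        qed
      qed
      then have "ereal a' \<le> (INF x. U k x)" by (intro INF_greatest)
      then show ?case using a' by (meson less_le_trans)
    qed
  qed
qed

section \<open>Infima of maxima, minima and translates\<close>

text \<open>The sublevel sets of \<open>u\<close> and \<open>v\<close> are closed and cover a segment joining them, so they meet.\<close>
lemma INF_max_eq:
  fixes u v :: "'a::euclidean_space \<Rightarrow> ereal"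
  assumes u: "lower_semicontinuous u" and v: "lower_semicontinuous v"
    and cvx: "convex_ereal (\<lambda>x. min (u x) (v x))"
  shows "(INF x. max (u x) (v x)) = max (INF x. u x) (INF x. v x)"
proof (rule antisym)
  show "max (INF x. u x) (INF x. v x) \<le> (INF x. max (u x) (v x))"
    by (intro max.boundedI INF_mono') auto
  show "(INF x. max (u x) (v x)) \<le> max (INF x. u x) (INF x. v x)"
  \<comment> \<open>Under these hypotheses the infima need not be attained, so the argument runs at
    a real level \<open>c\<close> strictly above both.\<close>
  proof (rule dense_ge)
    fix b assume "max (INF x. u x) (INF x. v x) < b"
    then obtain c where c: "max (INF x. u x) (INF x. v x) < ereal c" "ereal c < b"
      using ereal_dense2 by blast
    then obtain x y where xy: "u x < ereal c" "v y < ereal c"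
      by (auto simp: INF_less_iff)
    define A where "A = {x. u x \<le> ereal c}"
    define B where "B = {x. v x \<le> ereal c}"
    have "closed A" "closed B"
      unfolding A_def B_def
      by (rule lower_semicontinuous_closed_sublevel, fact)+
    moreover have "closed_segment x y \<subseteq> A \<union> B"
    proof
      fix z assume z: "z \<in> closed_segment x y"
      have "min (u z) (v z) \<le> ereal c"
        by (rule convex_ereal_segment_le[OF cvx _ _ z]) (use xy in \<open>auto simp: min_le_iff_disj\<close>)
      then show "z \<in> A \<union> B" by (auto simp: A_def B_def min_le_iff_disj)
    qed
    moreover have "x \<in> A \<inter> closed_segment x y" "y \<in> B \<inter> closed_segment x y"
      using xy by (auto simp: A_def B_def)
    ultimately have "A \<inter> B \<inter> closed_segment x y \<noteq> {}"
      using connected_closedD[OF connected_segment[of x y]] by (metis emptyE)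
    then obtain z where "max (u z) (v z) \<le> ereal c" by (auto simp: A_def B_def)
    then have "(INF x. max (u x) (v x)) \<le> ereal c" by (rule INF_lower2[OF UNIV_I])
    then show "(INF x. max (u x) (v x)) \<le> b" using c by simp
  qed
qed

lemma INF_min_eq:
  fixes u v :: "'a \<Rightarrow> ereal"
  shows "(INF x. min (u x) (v x)) = min (INF x. u x) (INF x. v x)"
  using INF_inf_distrib[of u UNIV v] by (simp only: inf_min)

lemma INF_translation:
  fixes u :: "'a::group_add \<Rightarrow> ereal"
  shows "(INF x. u (x - a)) = (INF x. u x)"
proof -
  have "range (\<lambda>x. u (x - a)) = range u"
    by (auto simp: image_iff) (metis add_diff_cancel)
  then show ?thesis by simp
qed

section \<open>Test functions and growth comparison\<close>

text \<open>The convex indicator of the origin, shifted by \<open>c\<close>. Epi-multiplication only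
  rescales \<open>c\<close>, so the orbit of \<open>point_fun 1\<close> realises every positive real
  as an infimum.\<close>

definition point_fun :: "real \<Rightarrow> 'a::zero \<Rightarrow> ereal" where
  "point_fun c x = (if x = 0 then ereal c else \<infinity>)"

lemma INF_point_fun: "(INF x. point_fun c x) = ereal c"
  by (rule antisym[OF INF_lower2[of 0]]) (auto simp: point_fun_def intro!: INF_greatest)

lemma epi_mult_point_fun: "c > 0 \<Longrightarrow> epi_mult c (point_fun d) = point_fun (c * d)"
  by (auto simp: epi_mult_def point_fun_def)

lemma point_fun_in_Conv_sc: "(point_fun c :: 'a::euclidean_space \<Rightarrow> ereal) \<in> Conv_sc"
proof -
  let ?u = "point_fun c :: 'a \<Rightarrow> ereal"
  have "convex_ereal ?u"
    unfolding convex_ereal_def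
  proof (intro allI ballI)
    fix x y :: 'a and t :: real assume t: "t \<in> {0..1}"
    \<comment> \<open>The endpoints are separate because zero times infinity is 0 in
      \<open>ereal\<close>. For interior \<open>t\<close>, the right side is infinite unless both
      points are 0.\<close>
    then consider "t = 0" | "t = 1" | "0 < t" "t < 1" by fastforce
    then show "?u ((1 - t) *\<^sub>R x + t *\<^sub>R y) \<le> ereal (1 - t) * ?u x + ereal t * ?u y"
    proof cases
      case 3
      then show ?thesis by (auto simp: point_fun_def algebra_simps)
    qed (simp_all add: zero_ereal_def[symmetric] one_ereal_def[symmetric])
  qed
  moreover have "lower_semicontinuous ?u"
    unfolding lower_semicontinuous_def
  proof
    fix x :: 'a
    \<comment> \<open>The filter \<open>at x\<close> omits \<open>x\<close> itself, so this also
      holds at the origin; all nearby values are then infinite.\<close>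
    have "\<forall>\<^sub>F y in at x. y \<noteq> 0"
      by (rule eventually_neq_at_within)
    then have "\<forall>\<^sub>F y in at x. ?u x \<le> ?u y"
      by eventually_elim (simp add: point_fun_def)
    then show "?u x \<le> Liminf (at x) ?u" by (rule Liminf_bounded)
  qed
  moreover have "((\<lambda>x. ?u x / ereal (norm x)) \<longlongrightarrow> \<infinity>) at_infinity"
  proof (rule tendsto_eventually)
    have "\<forall>\<^sub>F x in at_infinity. 1 \<le> norm (x::'a)" by (auto simp: eventually_at_infinity)
    then show "\<forall>\<^sub>F x in at_infinity. ?u x / ereal (norm x) = \<infinity>"
      by eventually_elim (auto simp: point_fun_def)
  qed
  moreover have "?u x \<noteq> -\<infinity>" for x by (simp add: point_fun_def)
  moreover have "?u 0 \<noteq> \<infinity>" by (simp add: point_fun_def)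
  ultimately show ?thesis unfolding Conv_sc_def Conv_def by blast
qed

text \<open>If equality held for all positive \<open>c\<close>, dividing by \<open>exp c\<close>
  would make the sum constantly 1, while each of its finitely many terms tends to 0 at
  infinity.\<close>

lemma exp_not_sum_powr:
  fixes \<alpha> a :: "nat \<Rightarrow> real"
  shows "\<exists>c>0. exp c \<noteq> (\<Sum>i<m. c powr \<alpha> i * a i)"
proof (rule ccontr)
  assume "\<not> ?thesis"
  then have eq: "exp c = (\<Sum>i<m. c powr \<alpha> i * a i)" if "c > 0" for c
    using that by blast
  have "((\<lambda>c. c powr \<alpha> i / exp c) \<longlongrightarrow> 0) at_top" for i
  proof (rule tendsto_sandwich[OF _ _ tendsto_const tendsto_power_div_exp_0])
    \<comment> \<open>For \<open>c\<close> at least 1 the real exponent may be rounded up to a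
      natural number; \<open>nat\<close> sends negative ones to 0.\<close>
    show "\<forall>\<^sub>F c in at_top. c powr \<alpha> i / exp c \<le> c ^ nat \<lceil>\<alpha> i\<rceil> / exp c"
      using eventually_ge_at_top[of "1::real"]
    proof eventually_elim
      case (elim c)
      then have "c powr \<alpha> i \<le> c powr real (nat \<lceil>\<alpha> i\<rceil>)"
        by (intro powr_mono of_nat_ceiling)
      then show ?case using elim by (simp add: powr_realpow divide_right_mono)
    qed
  qed simp
  then have "((\<lambda>c. \<Sum>i<m. c powr \<alpha> i / exp c * a i) \<longlongrightarrow> (\<Sum>i<m. 0 * a i)) at_top"
    by (intro tendsto_sum tendsto_mult tendsto_const)
  moreover have "\<forall>\<^sub>F c in at_top. (\<Sum>i<m. c powr \<alpha> i / exp c * a i) = 1"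
    using eventually_gt_at_top[of "0::real"]
  proof eventually_elim
    case (elim c)
    have "(\<Sum>i<m. c powr \<alpha> i / exp c * a i) = (\<Sum>i<m. c powr \<alpha> i * a i) / exp c"
      by (simp add: sum_divide_distrib)
    then show ?case by (simp flip: eq[OF elim])
  qed
  ultimately have "((\<lambda>c::real. 1::real) \<longlongrightarrow> (\<Sum>i<m. 0 * a i)) at_top"
    by (rule Lim_transform_eventually)
  then show False by (simp add: tendsto_const_iff)
qed

section \<open>The exponential of the infimum\<close>

theorem theorem29:
  shows "\<exists>Z :: (real ^ 'n \<Rightarrow> ereal) \<Rightarrow> real.
    epi_continuous_on Conv_sc Z \<and> translation_invariant_on Conv_sc Z \<and> valuation_on Conv_sc Z \<and>
    \<not> (\<exists>(m::nat) (Y :: nat \<Rightarrow> (real ^ 'n \<Rightarrow> ereal) \<Rightarrow> real).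
          (\<forall>i<m. valuation_on Conv_sc (Y i) \<and> epi_homogeneous_on Conv_sc (Y i)) \<and>
          (\<forall>u\<in>Conv_sc. Z u = (\<Sum>i<m. Y i u)))"
proof -
  \<comment> \<open>\<open>real_of_ereal\<close> loses nothing on \<open>Conv_sc\<close>, where the
    infimum is finite.\<close>
  define Z :: "(real ^ 'n \<Rightarrow> ereal) \<Rightarrow> real" where "Z u = exp (real_of_ereal (INF x. u x))" for u
  have "epi_continuous_on Conv_sc Z"
    unfolding epi_continuous_on_def
  proof (intro allI impI, elim conjE)
    fix U and u :: "real ^ 'n \<Rightarrow> ereal"
    assume U: "\<forall>k. U k \<in> Conv_sc" and u: "u \<in> Conv_sc" and epi: "epi_converges U u"
    obtain m where m: "(INF x. u x) = ereal m" using Conv_sc_INF_finite[OF u] by blast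
    have "(\<lambda>k. INF x. U k x) \<longlonglongrightarrow> (INF x. u x)"
      using U u epi by (intro epi_converges_INF) (auto simp: Conv_sc_def Conv_def)
    then have "(\<lambda>k. real_of_ereal (INF x. U k x)) \<longlonglongrightarrow> m"
      unfolding m by (rule lim_real_of_ereal)
    then show "(\<lambda>k. Z (U k)) \<longlonglongrightarrow> Z u"
      unfolding Z_def m by (simp add: tendsto_exp)
  qed
  moreover have "translation_invariant_on Conv_sc Z"
    by (simp add: translation_invariant_on_def Z_def INF_translation)
  moreover have "valuation_on Conv_sc Z"
    unfolding valuation_on_def
  proof (intro ballI impI)
    fix u v :: "real ^ 'n \<Rightarrow> ereal"
    assume "u \<in> Conv_sc" "v \<in> Conv_sc"
      "(\<lambda>x. max (u x) (v x)) \<in> Conv_sc \<and> (\<lambda>x. min (u x) (v x)) \<in> Conv_sc"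
    then have "(INF x. max (u x) (v x)) = max (INF x. u x) (INF x. v x)"
      by (intro INF_max_eq) (auto simp: Conv_sc_def Conv_def)
    \<comment> \<open>The infima of the maximum and the minimum are those of \<open>u\<close> and
      \<open>v\<close> in some order.\<close>
    then show "Z (\<lambda>x. max (u x) (v x)) + Z (\<lambda>x. min (u x) (v x)) = Z u + Z v"
      by (simp add: Z_def INF_min_eq)
  qed
  moreover have "\<not> (\<exists>m Y. (\<forall>i<m. valuation_on Conv_sc (Y i) \<and> epi_homogeneous_on Conv_sc (Y i)) \<and>
      (\<forall>u\<in>Conv_sc. Z u = (\<Sum>i<(m::nat). Y i u)))"
  proof (rule notI, elim exE conjE)
    fix m :: nat and Y :: "nat \<Rightarrow> (real ^ 'n \<Rightarrow> ereal) \<Rightarrow> real"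
    assume Y: "\<forall>i<m. valuation_on Conv_sc (Y i) \<and> epi_homogeneous_on Conv_sc (Y i)"
      "\<forall>u\<in>Conv_sc. Z u = (\<Sum>i<m. Y i u)"
    \<comment> \<open>Along the dilates of this single function, each summand is a constant times a
      power of \<open>c\<close>, whereas \<open>Z\<close> equals \<open>exp c\<close>.\<close>
    let ?p = "point_fun 1 :: real ^ 'n \<Rightarrow> ereal"
    have "\<forall>i\<in>{..<m}. \<exists>\<alpha>. \<forall>u\<in>Conv_sc. \<forall>c>0. Y i (epi_mult c u) = c powr \<alpha> * Y i u"
      using Y(1) by (simp add: epi_homogeneous_on_def)
    from bchoice[OF this] obtain \<alpha>
      where \<alpha>: "\<forall>i\<in>{..<m}. \<forall>u\<in>Conv_sc. \<forall>c>0. Y i (epi_mult c u) = c powr \<alpha> i * Y i u" ..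
    have "exp c = (\<Sum>i<m. c powr \<alpha> i * Y i ?p)" if c: "c > 0" for c
    proof -
      have "exp c = Z (epi_mult c ?p)"
        using c by (simp add: Z_def epi_mult_point_fun INF_point_fun)
      also have "\<dots> = (\<Sum>i<m. Y i (epi_mult c ?p))"
        using Y(2) c by (simp add: epi_mult_point_fun point_fun_in_Conv_sc)
      also have "\<dots> = (\<Sum>i<m. c powr \<alpha> i * Y i ?p)"
        using \<alpha> c by (intro sum.cong) (auto simp: point_fun_in_Conv_sc)
      finally show ?thesis .
    qed
    then show False
      using exp_not_sum_powr[where \<alpha> = \<alpha> and m = m and a = "\<lambda>i. Y i ?p"] by blast
  qed
  ultimately show ?thesis by (intro exI[of _ Z] conjI)
qed

end
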